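(* Let $d\ge2$. The star duality $\Phi:\mathcal{S}_{rc}^d\to\mathcal{S}_{rc}^d$ is continuous with respect to the radial Wijsman topology $\tau_{W^r}$ (on both domain and codomain).
   Context: $B_2^d$ and $\mathbb{S}^{d-1}$ are the closed Euclidean unit ball and the unit sphere of $\mathbb{R}^d$. A star set is a non-empty $A\subseteq\mathbb{R}^d$ with $ta\in A$ for all $a\in A$, $0\le t\le 1$. Its radial function is $\rho_A:\mathbb{S}^{d-1}\to[0,\infty]$, $\rho_A(\theta)=\sup\{\lambda\ge 0:\lambda\theta\in A\}$. A star body is a star set $A$ that is radially closed: $\rho_A(\theta)\theta\in A$ whenever $\rho_A(\theta)<\infty$ (it may be unbounded or non-closed; it is determined by $\rho_A$). $\mathcal{S}_{rc}^d$ is the family of all star bodies in $\mathbb{R}^d$. The star duality $\Phi$ sends $A\in\mathcal{S}_{rc}^d$ to the star body $\Phi(A)$ with radial function $\rho_{\Phi(A)}=1/\rho_A$, with the conventions $1/0=\infty$, $1/\infty=0$. The radial sum $A_1\tilde{+}A_2$ is the star body with radial function $\rho_{A_1}+\rho_{A_2}$. The radial distance from $x\in\mathbb{R}^d$ to $A\in\mathcal{S}_{rc}^d$ is $d_r(x,A)=\inf\{\alpha>0: x\in A\tilde{+}\alpha B_2^d\}\in[0,\infty)$. The radial Wijsman topology $\tau_{W^r}$ on $\mathcal{S}_{rc}^d$ is the weakest topology making all maps $A\mapsto d_r(x,A)$, $x\in\mathbb{R}^d$, continuous. *)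

theory Defs
  imports "HOL-Analysis.Analysis"
begin

definition star_set :: "'a::euclidean_space set \<Rightarrow> bool" where
  "star_set A \<longleftrightarrow> A \<noteq> {} \<and> (\<forall>a\<in>A. \<forall>t::real. 0 \<le> t \<and> t \<le> 1 \<longrightarrow> t *\<^sub>R a \<in> A)"

text \<open>Only the values on the unit sphere are meaningful.\<close>

definition radial_function :: "'a::euclidean_space set \<Rightarrow> 'a \<Rightarrow> ennreal" where
  "radial_function A \<theta> = (SUP r\<in>{r::real. 0 \<le> r \<and> r *\<^sub>R \<theta> \<in> A}. ennreal r)"

definition star_body :: "'a::euclidean_space set \<Rightarrow> bool" where
  "star_body A \<longleftrightarrow> star_set A \<and>
     (\<forall>\<theta>\<in>sphere 0 1. radial_function A \<theta> < \<infinity> \<longrightarrow> enn2real (radial_function A \<theta>) *\<^sub>R \<theta> \<in> A)"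

definition star_body_of :: "('a::euclidean_space \<Rightarrow> ennreal) \<Rightarrow> 'a set" where
  "star_body_of f = (THE A. star_body A \<and> (\<forall>\<theta>\<in>sphere 0 1. radial_function A \<theta> = f \<theta>))"

text \<open>In \<^typ>\<open>ennreal\<close>, \<open>1 / 0 = \<infinity>\<close> and \<open>1 / \<infinity> = 0\<close>.\<close>

definition star_duality :: "'a::euclidean_space set \<Rightarrow> 'a set" where
  "star_duality A = star_body_of (\<lambda>\<theta>. 1 / radial_function A \<theta>)"

definition radial_sum :: "'a::euclidean_space set \<Rightarrow> 'a set \<Rightarrow> 'a set" where
  "radial_sum A B = star_body_of (\<lambda>\<theta>. radial_function A \<theta> + radial_function B \<theta>)"

definition radial_dist :: "'a::euclidean_space \<Rightarrow> 'a set \<Rightarrow> real" where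
  "radial_dist x A = Inf {\<alpha>::real. \<alpha> > 0 \<and> x \<in> radial_sum A ((\<lambda>y. \<alpha> *\<^sub>R y) ` cball 0 1)}"

definition radial_wijsman :: "'a::euclidean_space set topology" where
  "radial_wijsman =
     topology_generated_by {{A. star_body A \<and> radial_dist x A \<in> U} | x U. open U}"

text \<open>\<^const>\<open>star_body_of\<close> is well defined for every function.\<close>

lemma star_set_zero: "star_set A \<Longrightarrow> 0 \<in> A"
  unfolding star_set_def by (metis all_not_in_conv order_refl scaleR_zero_left zero_le_one)

lemma star_body_mem_iff:
  assumes A: "star_body A" and \<theta>: "norm \<theta> = 1" and r: "0 \<le> r"
  shows "r *\<^sub>R \<theta> \<in> A \<longleftrightarrow> ennreal r \<le> radial_function A \<theta>"
proof
  assume "r *\<^sub>R \<theta> \<in> A"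
  then show "ennreal r \<le> radial_function A \<theta>"
    unfolding radial_function_def using r by (intro SUP_upper) auto
next
  assume le: "ennreal r \<le> radial_function A \<theta>"
  have star: "\<And>a t::real. a \<in> A \<Longrightarrow> 0 \<le> t \<Longrightarrow> t \<le> 1 \<Longrightarrow> t *\<^sub>R a \<in> A"
    using A by (auto simp: star_body_def star_set_def)
  have "\<exists>s\<ge>r. s *\<^sub>R \<theta> \<in> A"
  proof (cases "radial_function A \<theta> < \<infinity>")
    case True
    then have "enn2real (radial_function A \<theta>) *\<^sub>R \<theta> \<in> A"
      using A \<theta> by (auto simp: star_body_def)
    moreover have "r \<le> enn2real (radial_function A \<theta>)"
      using enn2real_mono[OF le] True r by simp
    ultimately show ?thesis by blast
  next
    case False
    then have "ennreal r < radial_function A \<theta>"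
      by (metis ennreal_less_top infinity_ennreal_def not_le order_less_le_trans)
    then show ?thesis
      unfolding radial_function_def less_SUP_iff
      using r by (auto simp: ennreal_less_iff intro: less_imp_le)
  qed
  then obtain s where s: "s \<ge> r" "s *\<^sub>R \<theta> \<in> A" by blast
  show "r *\<^sub>R \<theta> \<in> A"
  proof (cases "s = 0")
    case True
    then show ?thesis using s r by simp
  next
    case False
    then show ?thesis using star[OF s(2), of "r / s"] s r by simp
  qed
qed

lemma ex1_star_body_of:
  fixes f :: "'a::euclidean_space \<Rightarrow> ennreal"
  shows "\<exists>!A. star_body A \<and> (\<forall>\<theta>\<in>sphere 0 1. radial_function A \<theta> = f \<theta>)"
proof (rule ex_ex1I)
  define A where "A = {x::'a. x = 0 \<or> ennreal (norm x) \<le> f (sgn x)}"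
  have mem: "r *\<^sub>R \<theta> \<in> A \<longleftrightarrow> ennreal r \<le> f \<theta>" if "norm \<theta> = 1" "0 \<le> r" for r \<theta>
  proof (cases "r = 0")
    case False
    then show ?thesis using that by (auto simp: A_def sgn_div_norm)
  qed (simp add: A_def)
  have rad: "radial_function A \<theta> = f \<theta>" if \<theta>: "norm \<theta> = 1" for \<theta>
  proof (rule antisym)
    show "radial_function A \<theta> \<le> f \<theta>"
      unfolding radial_function_def by (rule SUP_least) (use mem[OF \<theta>] in auto)
    show "f \<theta> \<le> radial_function A \<theta>"
    proof (rule ccontr)
      assume "\<not> f \<theta> \<le> radial_function A \<theta>"
      then obtain y where y: "radial_function A \<theta> < y" "y < f \<theta>"
        using dense by (meson not_le)
      then obtain r where r: "0 \<le> r" "y = ennreal r"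
        by (metis ennreal_cases not_top_less top_greatest less_le_not_le)
      then have "r *\<^sub>R \<theta> \<in> A" using mem[OF \<theta>] y by auto
      then have "y \<le> radial_function A \<theta>"
        unfolding radial_function_def using r by (auto intro!: SUP_upper)
      with y show False by simp
    qed
  qed
  have "star_set A"
    unfolding star_set_def
  proof (intro conjI ballI allI impI)
    show "A \<noteq> {}" by (auto simp: A_def)
    fix a and t :: real assume a: "a \<in> A" and t: "0 \<le> t \<and> t \<le> 1"
    show "t *\<^sub>R a \<in> A"
    proof (cases "t = 0 \<or> a = 0")
      case False
      then have "ennreal (norm (t *\<^sub>R a)) \<le> ennreal (norm a)"
        using t by (intro ennreal_leI) (simp add: mult_left_le_one_le)
      moreover have "sgn (t *\<^sub>R a) = sgn a"
        using False t by (simp add: sgn_scaleR)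
      ultimately show ?thesis using a False unfolding A_def
        by (metis (mono_tags, lifting) mem_Collect_eq order_trans)
    qed (auto simp: A_def)
  qed
  moreover have "enn2real (radial_function A \<theta>) *\<^sub>R \<theta> \<in> A"
    if "norm \<theta> = 1" "radial_function A \<theta> < \<infinity>" for \<theta>
    using that mem[of \<theta>] rad[of \<theta>] by simp
  ultimately have "star_body A" by (simp add: star_body_def)
  with rad show "\<exists>A. star_body A \<and> (\<forall>\<theta>\<in>sphere 0 1. radial_function A \<theta> = f \<theta>)"
    by auto
next
  fix A B
  assume A: "star_body A \<and> (\<forall>\<theta>\<in>sphere 0 1. radial_function A \<theta> = f \<theta>)"
    and B: "star_body B \<and> (\<forall>\<theta>\<in>sphere 0 1. radial_function B \<theta> = f \<theta>)"
  have "x \<in> A \<longleftrightarrow> x \<in> B" for x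
  proof (cases "x = 0")
    case True
    then show ?thesis using A B star_set_zero by (auto simp: star_body_def)
  next
    case False
    then have n: "norm (sgn x) = 1" and x: "x = norm x *\<^sub>R sgn x"
      by (simp_all add: norm_sgn sgn_div_norm)
    then have "norm x *\<^sub>R sgn x \<in> A \<longleftrightarrow> norm x *\<^sub>R sgn x \<in> B"
      using A B star_body_mem_iff[of _ "sgn x" "norm x"] by auto
    with x show ?thesis by simp
  qed
  then show "A = B" by blast
qed

text \<open>The points of \<^const>\<open>radial_wijsman\<close> are the star bodies, and it is the weakest
  topology on them for which all the maps \<open>radial_dist x\<close> are continuous.\<close>

lemma topspace_radial_wijsman: "topspace radial_wijsman = {A. star_body A}"
proof -
  have "{A. star_body A} = {A. star_body A \<and> radial_dist 0 A \<in> UNIV}" by simp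
  then have "{A. star_body A} \<in> {{A. star_body A \<and> radial_dist x A \<in> U} | x U. open U}"
    using open_UNIV by blast
  then show ?thesis
    unfolding radial_wijsman_def topology_generated_by_topspace by blast
qed

lemma continuous_map_radial_dist: "continuous_map radial_wijsman euclideanreal (radial_dist x)"
proof -
  have "openin radial_wijsman {A. star_body A \<and> radial_dist x A \<in> U}" if "open U" for U
    unfolding radial_wijsman_def by (rule topology_generated_by_Basis) (use that in blast)
  then show ?thesis
    by (simp add: continuous_map_def topspace_radial_wijsman)
qed

lemma radial_wijsman_weakest:
  fixes X :: "'a::euclidean_space set topology"
  assumes top: "topspace X = {A. star_body A}"
    and cont: "\<And>x. continuous_map X euclideanreal (radial_dist x)"
    and U: "openin radial_wijsman U"
  shows "openin X U"
proof -
  have basis: "openin X V"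
    if V: "V \<in> {{A. star_body A \<and> radial_dist x A \<in> W} | x W. open W}" for V
  proof -
    obtain x W where "V = {A \<in> topspace X. radial_dist x A \<in> W}" "open W"
      using V top by auto
    then show ?thesis using cont[of x] by (simp add: continuous_map_def)
  qed
  show ?thesis
    by (rule generate_topology_on_coarsest[OF _ basis])
       (use U in \<open>auto simp: radial_wijsman_def openin_topology_generated_by_iff\<close>)
qed

end

theory Submission
  imports Defs
begin

text \<open>At \<open>r \<theta>\<close> with \<open>r \<ge> 0\<close> and \<open>\<theta>\<close> a unit vector, the radial distance to \<open>A\<close> is the positive part
  of \<open>r - \<rho>\<^sub>A(\<theta>)\<close>. Since \<open>r\<close> is arbitrary, \<open>\<tau>\<^sub>W\<^sub>r\<close> is the topology of pointwise convergence of
  radial functions in \<open>[0, \<infinity>]\<close>, and \<open>t \<mapsto> 1 / t\<close> is continuous on \<open>[0, \<infinity>]\<close>.\<close>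

lemma star_body_star_body_of: "star_body (star_body_of f)"
  and radial_function_star_body_of: "norm \<theta> = 1 \<Longrightarrow> radial_function (star_body_of f) \<theta> = f \<theta>"
  using theI'[OF ex1_star_body_of[of f]] by (auto simp: star_body_of_def)

lemma radial_function_cball:
  assumes "norm \<theta> = 1" "0 \<le> \<alpha>"
  shows "radial_function ((\<lambda>y. \<alpha> *\<^sub>R y) ` cball 0 1) \<theta> = ennreal \<alpha>"
proof -
  have "{r. 0 \<le> r \<and> r *\<^sub>R \<theta> \<in> (\<lambda>y. \<alpha> *\<^sub>R y) ` cball 0 1} = {0..\<alpha>}"
  proof (cases "\<alpha> = 0")
    case True
    then show ?thesis using assms by (auto simp: image_constant_conv)
  next
    case False
    then have "(\<lambda>y. \<alpha> *\<^sub>R y) ` cball (0::'a) 1 = cball 0 \<alpha>"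
      using cball_scale[of \<alpha> "0::'a" 1] assms by simp
    then show ?thesis using assms by auto
  qed
  moreover have "(SUP r\<in>{0..\<alpha>}. ennreal r) = ennreal \<alpha>"
    using assms by (intro antisym SUP_least SUP_upper) (auto intro: ennreal_leI)
  ultimately show ?thesis by (simp add: radial_function_def)
qed

text \<open>Along the ray through \<theta>, lying in the radial sum with the ball of radius \<alpha>
  means \<open>ennreal r \<le> radial_function A \<theta> + ennreal \<alpha>\<close>. Subtraction in
  \<open>ennreal\<close> is truncated at 0, so this bounds the difference by \<alpha>; an infinite
  radial function gives distance 0.\<close>

lemma radial_dist_scaleR:
  assumes "norm \<theta> = 1" "0 \<le> r"
  shows "radial_dist (r *\<^sub>R \<theta>) A = enn2real (ennreal r - radial_function A \<theta>)"
proof -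
  define t where "t = enn2real (ennreal r - radial_function A \<theta>)"
  \<comment> \<open>The difference is at most the finite \<open>ennreal r\<close>, so passing to the
    reals loses nothing.\<close>
  have t: "ennreal t = ennreal r - radial_function A \<theta>"
    by (simp add: t_def less_top[symmetric])
  have "r *\<^sub>R \<theta> \<in> radial_sum A ((\<lambda>y. \<alpha> *\<^sub>R y) ` cball 0 1) \<longleftrightarrow> t \<le> \<alpha>" if "\<alpha> > 0" for \<alpha>
  proof -
    have "r *\<^sub>R \<theta> \<in> radial_sum A ((\<lambda>y. \<alpha> *\<^sub>R y) ` cball 0 1) \<longleftrightarrow>
        ennreal r \<le> radial_function A \<theta> + ennreal \<alpha>"
      using assms that unfolding radial_sum_def
      by (subst star_body_mem_iff[OF star_body_star_body_of])
         (simp_all add: radial_function_star_body_of radial_function_cball)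
    also have "\<dots> \<longleftrightarrow> ennreal t \<le> ennreal \<alpha>"
      unfolding t by (auto simp: ennreal_minus_le_iff add.commute)
    finally show ?thesis using that by simp
  qed
  then have "radial_dist (r *\<^sub>R \<theta>) A = Inf {\<alpha>. \<alpha> > 0 \<and> t \<le> \<alpha>}"
    by (simp add: radial_dist_def cong: conj_cong)
  also have "\<dots> = t"
  \<comment> \<open>As \<alpha> must be positive, for \<open>t = 0\<close> the half-line is open and
    its infimum is not attained.\<close>
  proof (cases "t = 0")
    case True
    then have "{\<alpha>. \<alpha> > 0 \<and> t \<le> \<alpha>} = {0<..}" by auto
    then show ?thesis using True by simp
  next
    case False
    then have "t > 0" by (simp add: t_def less_le)
    then have "{\<alpha>. \<alpha> > 0 \<and> t \<le> \<alpha>} = {t..}" by auto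
    then show ?thesis by simp
  qed
  finally show ?thesis by (simp add: t_def)
qed

text \<open>The truncated differences \<open>ennreal r - y\<close> with finite \<open>r\<close>
  detect every open ray of [0, \<infinity>], hence its whole order topology. This links real-valued
  distances to extended-valued radial functions.\<close>

lemma continuous_map_ennreal_iff:
  fixes f :: "'a \<Rightarrow> ennreal"
  shows "continuous_map X euclidean f \<longleftrightarrow>
    (\<forall>r\<ge>0. continuous_map X euclideanreal (\<lambda>x. enn2real (ennreal r - f x)))"
proof (intro iffI allI impI)
  fix r :: real
  assume f: "continuous_map X euclidean f"
  \<comment> \<open>Subtraction could only fail to be continuous at \<infinity> - \<infinity>, which
    the finite \<open>ennreal r\<close> excludes.\<close>
  have "((\<lambda>y. ennreal r - y) \<longlongrightarrow> ennreal r - y) (at y)" for y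
    by (rule tendsto_diff_ennreal_general) auto
  then have "((\<lambda>y. ennreal r - y) \<longlongrightarrow> ennreal (enn2real (ennreal r - y))) (at y)" for y
    by (simp add: less_top[symmetric])
  then have "isCont (\<lambda>y. enn2real (ennreal r - y)) y" for y
    unfolding isCont_def by (rule tendsto_enn2real) simp
  then have "continuous_map euclidean euclideanreal (\<lambda>y. enn2real (ennreal r - y))"
    by (simp add: continuous_at_imp_continuous_on)
  from continuous_map_compose[OF f this]
  show "continuous_map X euclideanreal (\<lambda>x. enn2real (ennreal r - f x))"
    by (simp add: o_def)
next
  assume *: "\<forall>r\<ge>0. continuous_map X euclideanreal (\<lambda>x. enn2real (ennreal r - f x))"
  have op: "openin X {x \<in> topspace X. enn2real (ennreal r - f x) \<in> U}" if "0 \<le> r" "open U" for r U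
    using * that by (auto simp: continuous_map_def)
  have "openin X {x \<in> topspace X. f x \<in> U}" if "open U" for U
    using that unfolding open_generated_order
  proof induction
    case UNIV
    then show ?case by simp
  next
    case (Int U V)
    have "{x \<in> topspace X. f x \<in> U \<inter> V} =
        {x \<in> topspace X. f x \<in> U} \<inter> {x \<in> topspace X. f x \<in> V}" by auto
    then show ?case using Int by auto
  next
    case (UN K)
    have "{x \<in> topspace X. f x \<in> \<Union>K} = (\<Union>k\<in>K. {x \<in> topspace X. f x \<in> k})" by auto
    then show ?case using UN by auto
  next
    case (Basis S)
    then consider y where "S = {..<y}" | y where "S = {y<..}" by auto
    then show ?case
    proof cases
      case 1
      \<comment> \<open>A lower ray becomes a union over finite thresholds \<open>r\<close>: density
        yields a point strictly between \<open>f x\<close> and \<open>y\<close>, and being below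
        \<open>y\<close> makes it finite even for infinite \<open>y\<close>.\<close>
      have "f x < y \<longleftrightarrow> (\<exists>r\<in>{r. 0 \<le> r \<and> ennreal r \<le> y}. enn2real (ennreal r - f x) \<in> {0<..})" for x
      proof -
        have "f x < y \<longleftrightarrow> (\<exists>r\<in>{r. 0 \<le> r \<and> ennreal r \<le> y}. f x < ennreal r)"
        proof
          assume "f x < y"
          then obtain z where z: "f x < z" "z < y" using dense by blast
          then obtain r where "0 \<le> r" "z = ennreal r"
            by (metis ennreal_cases not_top_less)
          with z show "\<exists>r\<in>{r. 0 \<le> r \<and> ennreal r \<le> y}. f x < ennreal r" by auto
        qed auto
        then show ?thesis
          by (simp add: enn2real_positive_iff diff_gt_0_iff_gt_ennreal less_top[symmetric])
      qed
      then have "{x \<in> topspace X. f x \<in> S} = (\<Union>r\<in>{r. 0 \<le> r \<and> ennreal r \<le> y}.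
          {x \<in> topspace X. enn2real (ennreal r - f x) \<in> {0<..}})"
        using 1 by auto
      moreover have "openin X {x \<in> topspace X. enn2real (ennreal r - f x) \<in> {0<..}}"
        if "0 \<le> r" for r
        using op[OF that] open_greaterThan by blast
      ultimately show ?thesis by (auto simp del: greaterThan_iff)
    next
      case 2
      show ?thesis
      proof (cases y)
        case (real a)
        \<comment> \<open>The threshold exceeds \<open>a\<close> by 1, so that truncation does not
          act near \<open>f x = a\<close>. Where it does act, also for infinite \<open>f x\<close>,
          the value 0 is below 1, as required.\<close>
        have "y < f x \<longleftrightarrow> enn2real (ennreal (a + 1) - f x) \<in> {..<1}" for x
        proof (cases "f x")
          case (real b)
          then show ?thesis using \<open>0 \<le> a\<close> \<open>y = ennreal a\<close>
            by (auto simp: ennreal_minus_if ennreal_less_iff simp del: ennreal_plus)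
        qed (use real in \<open>simp_all add: diff_eq_0_ennreal del: ennreal_plus\<close>)
        then show ?thesis using 2 real op[of "a + 1" "{..<1}"] by simp
      qed (use 2 in auto)
    qed
  qed
  then show "continuous_map X euclidean f" by (simp add: continuous_map_def)
qed

lemma continuous_map_radial_function:
  assumes "norm \<theta> = 1"
  shows "continuous_map radial_wijsman euclidean (\<lambda>A. radial_function A \<theta>)"
  unfolding continuous_map_ennreal_iff
  by (simp add: radial_dist_scaleR[OF assms, symmetric] continuous_map_radial_dist)

text \<open>Evaluating radial functions at unit vectors induces the same initial topology as the
  maps \<open>radial_dist x\<close>, so continuity can be checked one direction at a time.\<close>

lemma continuous_map_radial_wijsman_iff:
  fixes F :: "'b \<Rightarrow> 'a::euclidean_space set"
  shows "continuous_map X radial_wijsman F \<longleftrightarrow>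
    (\<forall>x\<in>topspace X. star_body (F x)) \<and>
    (\<forall>\<theta>. norm \<theta> = 1 \<longrightarrow> continuous_map X euclidean (\<lambda>x. radial_function (F x) \<theta>))"
proof (intro iffI conjI ballI allI impI)
  assume F: "continuous_map X radial_wijsman F"
  then show "star_body (F x)" if "x \<in> topspace X" for x
    using that by (auto simp: continuous_map_def topspace_radial_wijsman)
  show "continuous_map X euclidean (\<lambda>x. radial_function (F x) \<theta>)" if "norm \<theta> = 1" for \<theta>
    using continuous_map_compose[OF F continuous_map_radial_function[OF that]] by (simp add: o_def)
next
  assume *: "(\<forall>x\<in>topspace X. star_body (F x)) \<and>
    (\<forall>\<theta>. norm \<theta> = 1 \<longrightarrow> continuous_map X euclidean (\<lambda>x. radial_function (F x) \<theta>))"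
  have cont: "continuous_map X euclideanreal (\<lambda>z. radial_dist x (F z))" for x
  proof -
    \<comment> \<open>The origin has no direction of its own; any unit vector serves, here a basis
      vector.\<close>
    obtain \<theta> :: 'a where \<theta>: "norm \<theta> = 1" "x = norm x *\<^sub>R \<theta>"
    proof (cases "x = 0")
      case True
      then show ?thesis using that[of "SOME b. b \<in> Basis"] by (simp add: norm_some_Basis)
    next
      case False
      then show ?thesis using that[of "sgn x"] by (simp add: norm_sgn sgn_div_norm)
    qed
    have "radial_dist x (F z) = enn2real (ennreal (norm x) - radial_function (F z) \<theta>)" for z
      using radial_dist_scaleR[OF \<theta>(1) norm_ge_zero[of x]] \<theta>(2) by simp
    then show ?thesis
      using * \<theta>(1) by (simp add: continuous_map_ennreal_iff)
  qed
  have "openin X (F -` V \<inter> topspace X)"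
    if V: "V \<in> {{A. star_body A \<and> radial_dist x A \<in> U} | x U. open U}" for V
  proof -
    obtain x U where U: "V = {A. star_body A \<and> radial_dist x A \<in> U}" "open U" using V by blast
    then have "F -` V \<inter> topspace X = {z \<in> topspace X. radial_dist x (F z) \<in> U}" using * by auto
    then show ?thesis using cont[of x] U by (simp add: continuous_map_def)
  qed
  moreover have "F ` topspace X \<subseteq> topspace radial_wijsman"
    using * by (auto simp: topspace_radial_wijsman)
  ultimately show "continuous_map X radial_wijsman F"
    unfolding radial_wijsman_def topology_generated_by_topspace
    by (rule continuous_on_generated_topo)
qed

theorem theorem5p4:
  assumes "CARD('n::finite) \<ge> 2"
  shows "continuous_map radial_wijsman radial_wijsman
           (star_duality :: (real ^ 'n) set \<Rightarrow> (real ^ 'n) set)"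
  unfolding continuous_map_radial_wijsman_iff
proof (intro conjI ballI allI impI)
  show "star_body (star_duality A)" for A :: "(real ^ 'n) set"
    by (simp add: star_duality_def star_body_star_body_of)
  fix \<theta> :: "real ^ 'n"
  assume \<theta>: "norm \<theta> = 1"
  \<comment> \<open>Continuity includes the endpoints, where \<open>inverse\<close> swaps 0 and
    \<infinity>, matching the conventions of the duality.\<close>
  have "continuous_map euclidean euclidean (inverse :: ennreal \<Rightarrow> ennreal)"
    by (simp add: continuous_on_inverse_ennreal continuous_on_id)
  from continuous_map_compose[OF continuous_map_radial_function[OF \<theta>] this]
  show "continuous_map radial_wijsman euclidean (\<lambda>A. radial_function (star_duality A) \<theta>)"
    using \<theta> by (simp add: star_duality_def radial_function_star_body_of divide_ennreal_def o_def)
qed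

end
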